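(* For every three-valued scheme $\mathbf{X}$, $\vDash^{ss\cap tt}_{\mathbf{X}} \ \neq\ \vDash_2$.
   Context: Language: $P$ is a denumerable (countably infinite) set of propositional variables, and $\mathcal{L}$ is the set of formulae generated from $P$ by the connectives $\neg$ (unary), $\wedge$, $\vee$ (binary). $\Gamma,\Delta$ range over arbitrary sets of formulae; a consequence relation is a set of pairs $(\Gamma,\Delta)$. Classical consequence $\vDash_2$: $\Gamma\vDash_2\Delta$ iff for every $v:\mathcal{L}\to\{0,1\}$ with $v(\neg A)=1-v(A)$, $v(A\wedge B)=\min(v(A),v(B))$, $v(A\vee B)=\max(v(A),v(B))$: if $v(A)=1$ for every $A\in\Gamma$, then $v(B)=1$ for some $B\in\Delta$. A three-valued scheme is a triple $\mathbf{X}=(f_\neg,f_\wedge,f_\vee)$ of operations on $\{1,\tfrac12,0\}$ (of arity $1,2,2$). An $\mathbf{X}$-valuation is a map $v:\mathcal{L}\to\{1,\tfrac12,0\}$ with $v(\neg A)=f_\neg(v(A))$, $v(A\wedge B)=f_\wedge(v(A),v(B))$, $v(A\vee B)=f_\vee(v(A),v(B))$. $\Gamma\vDash^{ss}_{\mathbf{X}}\Delta$ iff for every $\mathbf{X}$-valuation $v$: if $v(A)=1$ for every $A\in\Gamma$, then $v(B)=1$ for some $B\in\Delta$. $\Gamma\vDash^{tt}_{\mathbf{X}}\Delta$ iff for every $\mathbf{X}$-valuation $v$: if $v(A)\in\{1,\tfrac12\}$ for every $A\in\Gamma$, then $v(B)\in\{1,\tfrac12\}$ for some $B\in\Delta$.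 $\Gamma\vDash^{ss\cap tt}_{\mathbf{X}}\Delta$ iff $\Gamma\vDash^{ss}_{\mathbf{X}}\Delta$ and $\Gamma\vDash^{tt}_{\mathbf{X}}\Delta$. *)

theory Defs
  imports "HOL-Library.Countable_Set"
begin

(* The set P of propositional variables is the whole type 'p; that P is denumerable is
   expressed by assuming UNIV :: 'p set countable and infinite. *)
datatype 'p fm =
    Var 'p
  | Neg "'p fm"
  | Con "'p fm" "'p fm"
  | Dis "'p fm" "'p fm"

type_synonym 'p conseq = "('p fm set \<times> 'p fm set) set"

definition boolean_valuation :: "('p fm \<Rightarrow> int) \<Rightarrow> bool" where
  "boolean_valuation v \<longleftrightarrow>
     (\<forall>A. v A \<in> {0, 1}) \<and>
     (\<forall>A. v (Neg A) = 1 - v A) \<and>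
     (\<forall>A B. v (Con A B) = min (v A) (v B)) \<and>
     (\<forall>A B. v (Dis A B) = max (v A) (v B))"

definition classical_conseq :: "'p conseq" where
  "classical_conseq =
     {(\<Gamma>, \<Delta>). \<forall>v. boolean_valuation v \<longrightarrow> (\<forall>A\<in>\<Gamma>. v A = 1) \<longrightarrow> (\<exists>B\<in>\<Delta>. v B = 1)}"

datatype tv = One | Half | Zero

type_synonym scheme = "(tv \<Rightarrow> tv) \<times> (tv \<Rightarrow> tv \<Rightarrow> tv) \<times> (tv \<Rightarrow> tv \<Rightarrow> tv)"

fun scheme_valuation :: "scheme \<Rightarrow> ('p fm \<Rightarrow> tv) \<Rightarrow> bool" where
  "scheme_valuation (fneg, fcon, fdis) v \<longleftrightarrow>
     (\<forall>A. v (Neg A) = fneg (v A)) \<and>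
     (\<forall>A B. v (Con A B) = fcon (v A) (v B)) \<and>
     (\<forall>A B. v (Dis A B) = fdis (v A) (v B))"

definition ss_conseq :: "scheme \<Rightarrow> 'p conseq" where
  "ss_conseq X =
     {(\<Gamma>, \<Delta>). \<forall>v. scheme_valuation X v \<longrightarrow>
        (\<forall>A\<in>\<Gamma>. v A = One) \<longrightarrow> (\<exists>B\<in>\<Delta>. v B = One)}"

definition tt_conseq :: "scheme \<Rightarrow> 'p conseq" where
  "tt_conseq X =
     {(\<Gamma>, \<Delta>). \<forall>v. scheme_valuation X v \<longrightarrow>
        (\<forall>A\<in>\<Gamma>. v A \<in> {One, Half}) \<longrightarrow> (\<exists>B\<in>\<Delta>. v B \<in> {One, Half})}"

definition ss_inter_tt_conseq :: "scheme \<Rightarrow> 'p conseq" where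
  "ss_inter_tt_conseq X = ss_conseq X \<inter> tt_conseq X"

end

theory Submission
  imports Defs
begin

text \<open>The value \<open>Half\<close> cannot be negated. Excluded middle, with empty premises and conclusions
  \<open>p, \<not>p\<close>, is strictly valid only if the negation of \<open>Half\<close> is \<open>One\<close>, because \<open>Half\<close> is not
  strictly true; explosion, with premises \<open>p, \<not>p\<close> and empty conclusions, is tolerantly valid only
  if the negation of \<open>Half\<close> is \<open>Zero\<close>, because \<open>Half\<close> is tolerantly true. Both inferences are
  classically valid, so classical consequence is not even contained in the intersection.\<close>

primrec extend_assignment :: "scheme \<Rightarrow> ('p \<Rightarrow> tv) \<Rightarrow> 'p fm \<Rightarrow> tv" where
  "extend_assignment X g (Var p) = g p"
| "extend_assignment X g (Neg A) = fst X (extend_assignment X g A)"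
| "extend_assignment X g (Con A B) =
     fst (snd X) (extend_assignment X g A) (extend_assignment X g B)"
| "extend_assignment X g (Dis A B) =
     snd (snd X) (extend_assignment X g A) (extend_assignment X g B)"

lemma scheme_valuation_extend_assignment: "scheme_valuation X (extend_assignment X g)"
  by (cases X) simp

lemma classical_excluded_middle: "({}, {A, Neg A}) \<in> classical_conseq"
  by (auto simp: classical_conseq_def boolean_valuation_def)

lemma classical_explosion: "({A, Neg A}, {}) \<in> classical_conseq"
  by (auto simp: classical_conseq_def boolean_valuation_def)

lemma ss_excluded_middle_imp_neg_Half:
  assumes "({}, {Var p, Neg (Var p)}) \<in> ss_conseq X"
  shows "fst X Half = One"
  using assms scheme_valuation_extend_assignment[of X "\<lambda>_. Half"]
  by (fastforce simp: ss_conseq_def)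

lemma tt_explosion_imp_neg_Half:
  assumes "({Var p, Neg (Var p)}, {}) \<in> tt_conseq X"
  shows "fst X Half = Zero"
  using assms scheme_valuation_extend_assignment[of X "\<lambda>_. Half"]
  by (cases "fst X Half") (fastforce simp: tt_conseq_def)+

theorem theorem3p2:
  fixes X :: scheme
  assumes "countable (UNIV :: 'p set)" and "infinite (UNIV :: 'p set)"
  shows "ss_inter_tt_conseq X \<noteq> (classical_conseq :: 'p conseq)"
proof
  fix p :: 'p
  assume eq: "ss_inter_tt_conseq X = (classical_conseq :: 'p conseq)"
  have "({}, {Var p, Neg (Var p)}) \<in> ss_conseq X"
    using classical_excluded_middle[of "Var p"] eq by (auto simp: ss_inter_tt_conseq_def)
  moreover have "({Var p, Neg (Var p)}, {}) \<in> tt_conseq X"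
    using classical_explosion[of "Var p"] eq by (auto simp: ss_inter_tt_conseq_def)
  ultimately show False
    using ss_excluded_middle_imp_neg_Half tt_explosion_imp_neg_Half by fastforce
qed

end
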